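(* Let $n\ge 1$ and let $G$ be a finite simple graph with $n$ vertices and $\left\lfloor \frac{n^2}{4}\right\rfloor+1$ edges. Then either $\tau_{\triangle}(G)=1$, or $G$ contains at least $n-2$ triangles.
   Context: A triangle covering set of a graph $G$ is a set of vertices containing at least one vertex of every triangle of $G$. The triangle covering number $\tau_{\triangle}(G)$ is the minimum size of a triangle covering set. Thus $\tau_{\triangle}(G)=1$ means that $G$ has a triangle and some single vertex lies in every triangle of $G$. *)

theory Defs
  imports Main
begin

definition simple_graph :: "'a set \<Rightarrow> 'a set set \<Rightarrow> bool" where
  "simple_graph V E \<longleftrightarrow> finite V \<and> (\<forall>e\<in>E. e \<subseteq> V \<and> card e = 2)"

(* A triangle is identified with its vertex set, so each triangle is counted once. *)
definition triangles :: "'a set \<Rightarrow> 'a set set \<Rightarrow> 'a set set" where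
  "triangles V E =
     {T. T \<subseteq> V \<and> card T = 3 \<and> (\<forall>x\<in>T. \<forall>y\<in>T. x \<noteq> y \<longrightarrow> {x, y} \<in> E)}"

definition triangle_cover :: "'a set \<Rightarrow> 'a set set \<Rightarrow> 'a set \<Rightarrow> bool" where
  "triangle_cover V E S \<longleftrightarrow> S \<subseteq> V \<and> (\<forall>T\<in>triangles V E. S \<inter> T \<noteq> {})"

(* For a simple graph the minimum exists, since V itself is a triangle cover. *)
definition triangle_covering_number :: "'a set \<Rightarrow> 'a set set \<Rightarrow> nat" where
  "triangle_covering_number V E = (LEAST k. \<exists>S. triangle_cover V E S \<and> card S = k)"

end

theory Submission
  imports Defs
begin

text \<open>
  For a vertex \<open>x\<close> split \<open>V\<close> into \<open>B = N(x)\<close> and \<open>A = V - N(x)\<close>, and let \<open>q(x)\<close> be the number of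
  edges inside a part. Then \<open>q(x) + |E|\<close> is the degree sum over \<open>A\<close> plus twice the number of
  triangles at \<open>x\<close>. Summing over \<open>x\<close>, where each \<open>a\<close> contributes \<open>d(a) (n - d(a)) \<le> n\<^sup>2 div 4\<close>,
  gives with \<open>t\<close> the number of triangles that \<open>q(x)\<close> is on average at most \<open>6 t / n - 1\<close>.
  Hence \<open>t > 0\<close>, and if \<open>t < n - 2\<close> some \<open>x\<close> has \<open>q(x) \<le> 4\<close>, even \<open>q(x) \<le> 3\<close> for \<open>n < 18\<close> and
  \<open>q(x) \<le> 2\<close> for \<open>n < 9\<close>.

  Every triangle contains an edge inside a part, so a vertex common to all these edges covers all
  triangles. Otherwise each such edge forms a triangle with every vertex of the other part, except
  for the few losses caused by the missing cross pairs, of which there are fewer than \<open>q(x)\<close>; this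
  leaves at least \<open>n - 2\<close> triangles.
\<close>

definition inner :: "'a set \<Rightarrow> 'a set \<Rightarrow> 'a set set \<Rightarrow> 'a set set" where
  "inner A B E = {e \<in> E. e \<subseteq> A \<or> e \<subseteq> B}"

definition nbrs :: "'a set set \<Rightarrow> 'a \<Rightarrow> 'a set" where
  "nbrs E x = {y. {x, y} \<in> E}"

lemma mult_le_square_div4: "x * y \<le> (x + y)\<^sup>2 div 4" for x y :: nat
proof -
  have "0 \<le> (int x - int y)\<^sup>2" by simp
  then have "int (4 * (x * y)) \<le> int ((x + y)\<^sup>2)"
    by (simp add: power2_eq_square algebra_simps)
  then show ?thesis by linarith
qed

context
  fixes V :: "'a set" and E :: "'a set set"
  assumes G: "simple_graph V E"
begin

lemma finite_vertices: "finite V"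
  using G by (simp add: simple_graph_def)

lemma edge_subset: "e \<in> E \<Longrightarrow> e \<subseteq> V"
  and edge_card: "e \<in> E \<Longrightarrow> card e = 2"
  using G by (auto simp: simple_graph_def)

lemma finite_edges: "finite E"
  using finite_vertices edge_subset by (meson Pow_iff finite_Pow_iff finite_subset subsetI)

lemma finite_triangles: "finite (triangles V E)"
  using finite_vertices by (auto simp: triangles_def intro: finite_subset[of _ "Pow V"])

lemma edge_obtain:
  assumes "e \<in> E"
  obtains x y where "e = {x, y}" "x \<noteq> y" "x \<in> V" "y \<in> V"
  using edge_card[OF assms] edge_subset[OF assms] by (auto simp: card_2_iff)

lemma nbrs_subset: "nbrs E x \<subseteq> V"
  using edge_subset by (auto simp: nbrs_def)

lemma not_in_nbrs: "x \<notin> nbrs E x"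
  using edge_card by (fastforce simp: nbrs_def)

section \<open>Degree counts over a vertex bipartition\<close>

lemma card_incident: "card {e \<in> E. x \<in> e} = card (nbrs E x)"
proof -
  have "bij_betw (\<lambda>y. {x, y}) (nbrs E x) {e \<in> E. x \<in> e}"
  proof (rule bij_betwI')
    fix y z show "({x, y} = {x, z}) = (y = z)" by (auto simp: doubleton_eq_iff)
  next
    fix y assume "y \<in> nbrs E x" then show "{x, y} \<in> {e \<in> E. x \<in> e}" by (auto simp: nbrs_def)
  next
    fix e assume "e \<in> {e \<in> E. x \<in> e}"
    then have e: "e \<in> E" "x \<in> e" by auto
    obtain u v where "e = {u, v}" using edge_obtain[OF e(1)] by metis
    with e show "\<exists>y\<in>nbrs E x. e = {x, y}"
      by (auto simp: nbrs_def insert_commute)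
  qed
  then show ?thesis by (simp add: bij_betw_same_card)
qed

text \<open>Both sides count each edge once if it crosses and twice if it lies inside a part; the
  second summand makes up for edges inside \<open>B\<close>, which have no end in
  \<open>A\<close>.\<close>

lemma sum_degrees_side:
  assumes "A \<union> B = V" "A \<inter> B = {}"
  shows "(\<Sum>a\<in>A. card (nbrs E a)) + 2 * card {e \<in> E. e \<subseteq> B} = card E + card (inner A B E)"
proof -
  have fA: "finite A" using finite_vertices assms by (metis finite_Un)
  have "(\<Sum>a\<in>A. card (nbrs E a)) = (\<Sum>a\<in>A. card {e \<in> E. a \<in> e})"
    by (simp add: card_incident)
  also have "\<dots> = (\<Sum>e\<in>E. card {a \<in> A. a \<in> e})"
    by (rule sum_multicount_gen) (use fA finite_edges in auto)
  finally have 1: "(\<Sum>a\<in>A. card (nbrs E a)) = (\<Sum>e\<in>E. card {a \<in> A. a \<in> e})" .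
  have 2: "card {e \<in> E. P e} = (\<Sum>e\<in>E. if P e then 1 else 0)" for P
    using finite_edges by (simp add: sum.If_cases Collect_conj_eq Int_commute)
  have 3: "card {a \<in> A. a \<in> e} + 2 * (if e \<subseteq> B then 1 else 0)
      = 1 + (if e \<subseteq> A \<or> e \<subseteq> B then 1 else 0)" if "e \<in> E" for e
  proof -
    obtain x y where xy: "e = {x, y}" "x \<noteq> y" "x \<in> V" "y \<in> V" using edge_obtain[OF \<open>e \<in> E\<close>] .
    have "{a \<in> A. a \<in> e} = (if x \<in> A then {x} else {}) \<union> (if y \<in> A then {y} else {})"
      using xy by auto
    then show ?thesis using xy assms by auto
  qed
  have "(\<Sum>e\<in>E. card {a \<in> A. a \<in> e}) + 2 * card {e \<in> E. e \<subseteq> B}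
      = (\<Sum>e\<in>E. card {a \<in> A. a \<in> e} + 2 * (if e \<subseteq> B then 1 else 0))"
    by (simp only: 2 sum.distrib sum_distrib_left)
  also have "\<dots> = (\<Sum>e\<in>E. 1 + (if e \<subseteq> A \<or> e \<subseteq> B then 1 else 0))"
    by (rule sum.cong[OF refl 3])
  also have "\<dots> = card E + card (inner A B E)"
    unfolding inner_def 2 by (simp only: sum.distrib card_eq_sum)
  finally show ?thesis using 1 by simp
qed

text \<open>Adjoining \<open>x\<close> to an edge among its neighbours is injective, because
  \<open>x\<close> is not its own neighbour.\<close>

lemma link_le_triangles:
  assumes "x \<in> V"
  shows "card {e \<in> E. e \<subseteq> nbrs E x} \<le> card {T \<in> triangles V E. x \<in> T}"
proof (rule card_inj_on_le[where f = "insert x"])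
  show "inj_on (insert x) {e \<in> E. e \<subseteq> nbrs E x}"
  proof (rule inj_onI, clarify)
    fix e f assume "e \<subseteq> nbrs E x" "f \<subseteq> nbrs E x" "insert x e = insert x f"
    then show "e = f" using not_in_nbrs by (metis insert_ident subsetD)
  qed
  show "finite {T \<in> triangles V E. x \<in> T}" using finite_triangles by simp
  show "insert x ` {e \<in> E. e \<subseteq> nbrs E x} \<subseteq> {T \<in> triangles V E. x \<in> T}"
  proof safe
    fix e assume e: "e \<in> E" "e \<subseteq> nbrs E x"
    obtain u v where uv: "e = {u, v}" "u \<noteq> v" "u \<in> V" "v \<in> V" using edge_obtain[OF e(1)] .
    with e not_in_nbrs assms have "x \<noteq> u" "x \<noteq> v" "{x, u} \<in> E" "{x, v} \<in> E"
      by (auto simp: nbrs_def)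
    with uv e assms show "insert x e \<in> triangles V E"
      by (auto simp: triangles_def insert_commute)
  qed
qed

text \<open>This sums \<open>sum_degrees_side\<close> over the cuts given by all neighbourhoods. The
  factor 6 is the 2 in front of the edges inside \<open>nbrs E x\<close> times the 3 vertices of a
  triangle.\<close>

lemma sum_inner_le:
  "(\<Sum>x\<in>V. card (inner (V - nbrs E x) (nbrs E x) E)) + card V * card E
     \<le> card V * ((card V)\<^sup>2 div 4) + 6 * card (triangles V E)"
proof -
  let ?n = "card V" and ?N = "nbrs E"
  have sym: "y \<in> ?N x \<longleftrightarrow> x \<in> ?N y" for x y by (auto simp: nbrs_def insert_commute)
  have "(\<Sum>x\<in>V. card (inner (V - ?N x) (?N x) E)) + ?n * card E
      = (\<Sum>x\<in>V. card E + card (inner (V - ?N x) (?N x) E))"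
    by (simp add: sum.distrib)
  also have "\<dots> = (\<Sum>x\<in>V. (\<Sum>a\<in>V - ?N x. card (?N a)) + 2 * card {e \<in> E. e \<subseteq> ?N x})"
    by (rule sum.cong[OF refl], rule sum_degrees_side[symmetric]) (use nbrs_subset in auto)
  also have "\<dots> = (\<Sum>x\<in>V. \<Sum>a\<in>V - ?N x. card (?N a)) + 2 * (\<Sum>x\<in>V. card {e \<in> E. e \<subseteq> ?N x})"
    by (simp add: sum.distrib sum_distrib_left)
  also have "(\<Sum>x\<in>V. card {e \<in> E. e \<subseteq> ?N x}) \<le> (\<Sum>x\<in>V. card {T \<in> triangles V E. x \<in> T})"
    by (rule sum_mono) (rule link_le_triangles)
  also have "(\<Sum>x\<in>V. card {T \<in> triangles V E. x \<in> T}) = (\<Sum>T\<in>triangles V E. 3)"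
  proof (rule sum_multicount_gen[OF finite_vertices finite_triangles], safe)
    fix T assume "T \<in> triangles V E"
    then have "{x \<in> V. x \<in> T} = T" "card T = 3" by (auto simp: triangles_def)
    then show "card {x \<in> V. x \<in> T} = 3" by simp
  qed
  \<comment> \<open>By symmetry of adjacency the condition on \<open>a\<close> becomes one on
    \<open>x\<close>; after the swap, \<open>a\<close> contributes its degree once per
    non-neighbour.\<close>
  also have "(\<Sum>x\<in>V. \<Sum>a\<in>V - ?N x. card (?N a))
      = (\<Sum>x\<in>V. \<Sum>a\<in>V. if x \<in> ?N a then 0 else card (?N a))"
    using finite_vertices sym
    by (intro sum.cong refl sum.mono_neutral_cong_left) auto
  also have "\<dots> = (\<Sum>a\<in>V. \<Sum>x\<in>V. if x \<in> ?N a then 0 else card (?N a))"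
    by (rule sum.swap)
  also have "\<dots> = (\<Sum>a\<in>V. card (?N a) * (?n - card (?N a)))"
  proof (rule sum.cong[OF refl])
    fix a
    have "(\<Sum>x\<in>V. if x \<in> ?N a then 0 else card (?N a)) = card (V - ?N a) * card (?N a)"
      using finite_vertices by (simp add: sum.If_cases Diff_eq)
    then show "(\<Sum>x\<in>V. if x \<in> ?N a then 0 else card (?N a)) = card (?N a) * (?n - card (?N a))"
      by (simp add: card_Diff_subset[OF finite_subset[OF nbrs_subset finite_vertices] nbrs_subset] mult.commute)
  qed
  also have "\<dots> \<le> (\<Sum>a\<in>V. ?n\<^sup>2 div 4)"
  proof (rule sum_mono)
    fix a
    have "card (?N a) \<le> ?n" by (rule card_mono[OF finite_vertices nbrs_subset])
    then obtain c where c: "?n = card (?N a) + c" using le_Suc_ex by blast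
    show "card (?N a) * (?n - card (?N a)) \<le> ?n\<^sup>2 div 4"
      unfolding c using mult_le_square_div4[of "card (?N a)" c] by simp
  qed
  finally show ?thesis by simp
qed

section \<open>Triangles and missing pairs across a cut\<close>

lemma missing_pairs_le:
  assumes "A \<union> B = V" "A \<inter> B = {}"
  shows "card {(x, y) \<in> A \<times> B. {x, y} \<notin> E} + card E \<le> card (inner A B E) + card A * card B"
proof -
  have fin: "finite A" "finite B" using finite_vertices assms by (metis finite_Un)+
  let ?M = "{(x, y) \<in> A \<times> B. {x, y} \<notin> E}" and ?C = "{(x, y) \<in> A \<times> B. {x, y} \<in> E}"
  \<comment> \<open>An edge that is not inner joins the two parts, hence comes from a pair in
    \<open>?C\<close>.\<close>
  have "E \<subseteq> inner A B E \<union> (\<lambda>(x, y). {x, y}) ` ?C"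
  proof
    fix e assume e: "e \<in> E"
    obtain x y where xy: "e = {x, y}" "x \<noteq> y" "x \<in> V" "y \<in> V" using edge_obtain[OF e] .
    show "e \<in> inner A B E \<union> (\<lambda>(x, y). {x, y}) ` ?C"
    proof (cases "e \<in> inner A B E")
      case False
      with e xy assms(1) have "(x \<in> A \<and> y \<in> B) \<or> (y \<in> A \<and> x \<in> B)"
        unfolding inner_def by blast
      with e xy(1) have "(x, y) \<in> ?C \<or> (y, x) \<in> ?C"
        by (auto simp: insert_commute)
      then show ?thesis
      proof
        assume "(x, y) \<in> ?C"
        from imageI[OF this, of "\<lambda>(x, y). {x, y}"] show ?thesis using xy(1) by simp
      next
        assume "(y, x) \<in> ?C"
        from imageI[OF this, of "\<lambda>(x, y). {x, y}"] show ?thesis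
          using xy(1) by (simp add: insert_commute)
      qed
    qed simp
  qed
  moreover have fC: "finite ?C" "finite ?M"
    using fin by (auto intro: finite_subset[of _ "A \<times> B"])
  moreover have "finite (inner A B E)" using finite_edges by (simp add: inner_def)
  ultimately have "card E \<le> card (inner A B E) + card ((\<lambda>(x, y). {x, y}) ` ?C)"
    by (meson card_Un_le card_mono finite_UnI finite_imageI order_trans)
  also have "card ((\<lambda>(x, y). {x, y}) ` ?C) \<le> card ?C" by (rule card_image_le[OF fC(1)])
  finally have "card E \<le> card (inner A B E) + card ?C" by simp
  moreover have "card ?M + card ?C = card (?M \<union> ?C)"
    by (rule card_Un_disjoint[symmetric]) (use fC in auto)
  moreover have "?M \<union> ?C = A \<times> B" by auto
  ultimately show ?thesis by (simp add: card_cartesian_product)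
qed

text \<open>Pair each inner edge with each vertex of the opposite part. The pair spans a triangle
  unless a missing cross pair joins the vertex to an end of the edge. For a fixed missing pair, the
  inner edge determines the lost candidate, so at most \<open>h\<close> are lost to it.\<close>

lemma triangles_from_inner:
  assumes "A \<union> B = V" "A \<inter> B = {}"
    and h: "\<And>x y. x \<in> A \<Longrightarrow> y \<in> B \<Longrightarrow> {x, y} \<notin> E \<Longrightarrow>
           card {e \<in> inner A B E. x \<in> e \<or> y \<in> e} \<le> h"
  shows "card {e \<in> E. e \<subseteq> A} * card B + card {e \<in> E. e \<subseteq> B} * card A
     \<le> card (triangles V E) + card {(x, y) \<in> A \<times> B. {x, y} \<notin> E} * h"
proof -
  have fin: "finite A" "finite B" using finite_vertices assms by (metis finite_Un)+
  let ?IA = "{e \<in> E. e \<subseteq> A}" and ?IB = "{e \<in> E. e \<subseteq> B}"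
  let ?M = "{(x, y) \<in> A \<times> B. {x, y} \<notin> E}"
  define P where "P = ?IA \<times> B \<union> ?IB \<times> A"
  define good where "good = {(e, w) \<in> P. \<forall>u\<in>e. {u, w} \<in> E}"
  \<comment> \<open>the candidate pairs in \<open>P\<close> destroyed by the missing cross pair \<open>m\<close>\<close>
  define hit where "hit m = (\<lambda>e. (e, if e \<subseteq> A then snd m else fst m)) `
      {e \<in> inner A B E. fst m \<in> e \<or> snd m \<in> e}" for m :: "'a \<times> 'a"
  have fI: "finite (inner A B E)" "finite ?IA" "finite ?IB"
    using finite_edges by (auto simp: inner_def)
  have fM: "finite ?M" using fin by (auto intro: finite_subset[of _ "A \<times> B"])
  have fP: "finite P" using fI fin by (simp add: P_def)
  have ne: "e \<noteq> {}" if "e \<in> E" for e using edge_card[OF that] by auto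
  have "card P = card (?IA \<times> B) + card (?IB \<times> A)"
    unfolding P_def by (rule card_Un_disjoint) (use fI fin assms(2) in auto)
  then have cP: "card P = card ?IA * card B + card ?IB * card A"
    by (simp add: card_cartesian_product)
  have PU: "P \<subseteq> good \<union> (\<Union>m\<in>?M. hit m)"
  proof
    fix p assume p: "p \<in> P"
    obtain e w where ew: "p = (e, w)" by force
    show "p \<in> good \<union> (\<Union>m\<in>?M. hit m)"
    proof (cases "p \<in> good")
      case False
      then obtain u where u: "u \<in> e" "{u, w} \<notin> E" using p ew by (auto simp: good_def)
      from p ew consider "e \<in> ?IA" "w \<in> B" | "e \<in> ?IB" "w \<in> A" by (auto simp: P_def)
      then show ?thesis
      proof cases
        case 1
        then have "(u, w) \<in> ?M" "p \<in> hit (u, w)" using u ew by (auto simp: hit_def inner_def)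
        then show ?thesis by blast
      next
        case 2
        \<comment> \<open>Pairs in \<open>?M\<close> list the vertex of \<open>A\<close> first, so
          \<open>u\<close> and \<open>w\<close> trade places here. Since \<open>e\<close> is
          nonempty and inside \<open>B\<close>, the second branch in \<open>hit\<close>
          applies.\<close>
        then have "\<not> e \<subseteq> A" using ne assms(2) by blast
        then have "p = (e, if e \<subseteq> A then snd (w, u) else fst (w, u))"
          "e \<in> {e \<in> inner A B E. fst (w, u) \<in> e \<or> snd (w, u) \<in> e}"
          using 2 u ew by (simp_all add: inner_def)
        then have "p \<in> hit (w, u)" unfolding hit_def by (rule image_eqI)
        moreover have "(w, u) \<in> ?M" using 2 u by (auto simp: insert_commute)
        ultimately have "(w, u) \<in> ?M" "p \<in> hit (w, u)" by blast+
        then show ?thesis by blast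
      qed
    qed simp
  qed
  have "finite (hit m)" for m using fI by (simp add: hit_def)
  moreover have "finite good" using fP by (auto simp: good_def intro: finite_subset[of _ P])
  ultimately have "finite (good \<union> (\<Union>m\<in>?M. hit m))" using fM by blast
  then have "card P \<le> card (good \<union> (\<Union>m\<in>?M. hit m))" using PU by (rule card_mono)
  also have "\<dots> \<le> card good + card (\<Union>m\<in>?M. hit m)" by (rule card_Un_le)
  also have "card (\<Union>m\<in>?M. hit m) \<le> (\<Sum>m\<in>?M. card (hit m))" by (rule card_UN_le[OF fM])
  also have "\<dots> \<le> (\<Sum>m\<in>?M. h)"
  proof (rule sum_mono)
    fix m assume m: "m \<in> ?M"
    have "card (hit m) \<le> card {e \<in> inner A B E. fst m \<in> e \<or> snd m \<in> e}"
      unfolding hit_def by (rule card_image_le) (use fI in simp)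
    also have "\<dots> \<le> h" using m h by auto
    finally show "card (hit m) \<le> h" .
  qed
  also have "card good \<le> card (triangles V E)"
  proof (rule card_inj_on_le[where f = "\<lambda>(e, w). insert w e"])
    show "inj_on (\<lambda>(e, w). insert w e) good"
    proof (rule inj_onI, clarify)
      fix e w e' w' assume ew: "(e, w) \<in> good" "(e', w') \<in> good" and eq: "insert w e = insert w' e'"
      \<comment> \<open>The triangle meets one part in two vertices and the other in one, so it
        determines both the edge and the apex.\<close>
      have sides: "(insert v f \<inter> A = f \<and> insert v f \<inter> B = {v} \<and> card f = 2) \<or>
          (insert v f \<inter> A = {v} \<and> insert v f \<inter> B = f \<and> card f = 2)" if "(f, v) \<in> good" for f v
        using that assms(2) edge_card unfolding good_def P_def by blast
      have "card {v} \<noteq> 2" for v :: 'a by simp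
      with sides[OF ew(1)] sides[OF ew(2)] eq show "e = e' \<and> w = w'"
        by (metis singleton_inject)
    qed
    show "(\<lambda>(e, w). insert w e) ` good \<subseteq> triangles V E"
    proof clarify
      fix e w assume ew: "(e, w) \<in> good"
      then have e: "e \<in> E" and w: "w \<in> V" "w \<notin> e" and a: "\<forall>u\<in>e. {u, w} \<in> E"
        using assms by (auto simp: good_def P_def)
      obtain x y where "e = {x, y}" "x \<noteq> y" "x \<in> V" "y \<in> V" using edge_obtain[OF e] .
      with e w a show "insert w e \<in> triangles V E"
        by (auto simp: triangles_def insert_commute)
    qed
  qed (rule finite_triangles)
  finally show ?thesis using cP by simp
qed

text \<open>Pigeonhole: two of the three vertices share a part.\<close>

lemma triangle_has_inner:
  assumes "A \<union> B = V" "T \<in> triangles V E"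
  shows "\<exists>e\<in>inner A B E. e \<subseteq> T"
proof -
  obtain x y z where T: "T = {x, y, z}" "x \<noteq> y" "x \<noteq> z" "y \<noteq> z"
    using assms(2) by (auto simp: triangles_def card_3_iff)
  then have "{x, y} \<in> E" "{x, z} \<in> E" "{y, z} \<in> E" "x \<in> A \<union> B" "y \<in> A \<union> B" "z \<in> A \<union> B"
    using assms by (auto simp: triangles_def)
  then have "{x, y} \<in> inner A B E \<or> {x, z} \<in> inner A B E \<or> {y, z} \<in> inner A B E"
    by (auto simp: inner_def)
  then show ?thesis unfolding T(1) by (elim disjE bexI[rotated]) auto
qed

lemma covering_number_1:
  assumes "triangles V E \<noteq> {}" "v \<in> V" "\<And>T. T \<in> triangles V E \<Longrightarrow> v \<in> T"
  shows "triangle_covering_number V E = 1"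
  unfolding triangle_covering_number_def
proof (rule Least_equality)
  show "\<exists>S. triangle_cover V E S \<and> card S = 1"
    using assms by (intro exI[of _ "{v}"]) (auto simp: triangle_cover_def)
next
  fix k assume "\<exists>S. triangle_cover V E S \<and> card S = k"
  then obtain S where S: "triangle_cover V E S" "card S = k" by blast
  then have "S \<noteq> {}" "finite S"
    using assms(1) finite_vertices by (auto simp: triangle_cover_def intro: finite_subset)
  then show "1 \<le> k" using S by (metis One_nat_def Suc_leI card_gt_0_iff)
qed

end

section \<open>Arithmetic of the part sizes\<close>

lemma side_gap:
  fixes a b D :: nat
  assumes "(a + b)\<^sup>2 div 4 = a * b + D"
  shows "a \<le> b + D + 1"
proof -
  \<comment> \<open>The shift by 2 is chosen so that expanding yields \<open>4 * (a - b - 1)\<close>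
    against \<open>(a + b)^2 - 4 * a * b\<close>; the multiple of 4 then passes through
    \<open>div\<close>.\<close>
  have "0 \<le> (int a - int b - 2)\<^sup>2" by simp
  then have "4 * int a + 4 * (int a * int b) \<le> int ((a + b)\<^sup>2) + 4 * int b + 4"
    by (simp add: power2_eq_square algebra_simps)
  then have "4 * (a + a * b) \<le> (a + b)\<^sup>2 + 4 * b + 4"
    by (simp flip: of_nat_mult of_nat_add of_nat_power)
  moreover have "s \<le> m div 4 + b + 1" if "4 * s \<le> m + 4 * b + 4" for s m :: nat
    using that by presburger
  ultimately have "a + a * b \<le> (a + b)\<^sup>2 div 4 + b + 1" by blast
  then show ?thesis using assms by simp
qed

text \<open>
  In the next two lemmas \<open>a\<close>, \<open>b\<close> are the sizes of the parts, \<open>D = (a + b)\<^sup>2 div 4 - a b\<close>, \<open>k\<close> is the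
  number of missing cross pairs, and a missing pair destroys at most \<open>q - 1\<close> (no common vertex,
  all inner edges on one side), respectively at most \<open>p + r\<close>, of the candidate triangles.
\<close>

lemma count_one_side:
  fixes a b D k q t :: nat
  assumes "a \<le> b + D + 1" "k + D + 1 \<le> q" "q * b \<le> t + k * (q - 1)"
    and "q = 2 \<or> q = 3 \<and> 9 \<le> a + b \<or> q = 4 \<and> 18 \<le> a + b"
  shows "a + b \<le> t + 2"
  using assms by auto

lemma count_both_sides:
  fixes a b D k p r t :: nat
  assumes "a \<le> b + D + 1" "b \<le> a + D + 1" "k + D + 1 \<le> p + r" "1 \<le> p" "1 \<le> r"
    and "p * b + r * a \<le> t + k * (p + r)"
    and "p + r = 2 \<or> p + r = 3 \<and> 9 \<le> a + b \<or> p + r = 4 \<and> 18 \<le> a + b"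
  shows "a + b \<le> t + 2"
proof -
  \<comment> \<open>Once \<open>p\<close> and \<open>r\<close> are numerals, the products in the
    hypotheses become linear.\<close>
  have "(p = 1 \<and> r = 1) \<or> (p = 1 \<and> r = 2) \<or> (p = 2 \<and> r = 1)
      \<or> (p = 1 \<and> r = 3) \<or> (p = 2 \<and> r = 2) \<or> (p = 3 \<and> r = 1)"
    using assms(4,5,7) by presburger
  then show ?thesis using assms by (elim disjE) auto
qed

section \<open>Choice of a cut with few inner edges, and the final count\<close>

theorem theorem4:
  fixes V :: "'a set" and E :: "'a set set" and n :: nat
  assumes "n \<ge> 1"
    and "simple_graph V E"
    and "card V = n"
    and "card E = n\<^sup>2 div 4 + 1"
  shows "triangle_covering_number V E = 1 \<or> int (card (triangles V E)) \<ge> int n - 2"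
proof (rule disjCI)
  assume "\<not> int (card (triangles V E)) \<ge> int n - 2"
  then have few: "card (triangles V E) + 3 \<le> n" by linarith
  note G = assms(2)
  let ?t = "card (triangles V E)"
  have finV: "finite V" and finE: "finite E"
    using finite_vertices[OF G] finite_edges[OF G] .
  define q where "q x = card (inner (V - nbrs E x) (nbrs E x) E)" for x
  \<comment> \<open>The one edge beyond \<open>n^2 div 4\<close>, counted once per vertex, leaves
    the summand \<open>n\<close>.\<close>
  have total: "(\<Sum>x\<in>V. q x) + n \<le> 6 * ?t"
    using sum_inner_le[OF G] unfolding assms(3,4) q_def by (simp add: algebra_simps)
  \<comment> \<open>Averaging: by \<open>total\<close>, the mean of \<open>q x + 1\<close> is at
    most \<open>6 * ?t / n\<close>.\<close>
  have "\<exists>x\<in>V. n * (q x + 1) \<le> 6 * ?t"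
  proof (rule ccontr)
    assume "\<not> (\<exists>x\<in>V. n * (q x + 1) \<le> 6 * ?t)"
    then have "(\<Sum>x\<in>V. 6 * ?t) < (\<Sum>x\<in>V. n * (q x + 1))"
      using assms(1,3) finV by (intro sum_strict_mono) auto
    also have "\<dots> = n * ((\<Sum>x\<in>V. q x) + n)"
      using assms(3) by (simp add: sum_distrib_left[symmetric] sum.distrib del: add_Suc_right)
    also have "\<dots> \<le> n * (6 * ?t)" using total by (rule mult_le_mono2)
    finally show False using assms(3) by simp
  qed
  then obtain x where x: "x \<in> V" "n * (q x + 1) \<le> 6 * ?t" by blast
  define A where "A = V - nbrs E x"
  define B where "B = nbrs E x"
  define I where "I = inner A B E"
  define p where "p = card {e \<in> E. e \<subseteq> A}"
  define r where "r = card {e \<in> E. e \<subseteq> B}"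
  define k where "k = card {(x, y) \<in> A \<times> B. {x, y} \<notin> E}"
  have AB: "A \<union> B = V" "A \<inter> B = {}" using nbrs_subset[OF G] by (auto simp: A_def B_def)
  have n: "card A + card B = n"
    using AB finV assms(3) by (metis card_Un_disjoint finite_Un)
  have finI: "finite I" using finE by (simp add: I_def inner_def)
  have ne: "e \<noteq> {}" if "e \<in> E" for e using edge_card[OF G that] by auto
  have Ipr: "card I = p + r"
  proof -
    have "I = {e \<in> E. e \<subseteq> A} \<union> {e \<in> E. e \<subseteq> B}" by (auto simp: I_def inner_def)
    then show ?thesis unfolding p_def r_def
      using finE ne AB(2) by (subst card_Un_disjoint[symmetric]) auto
  qed
  have tpos: "triangles V E \<noteq> {}" using total assms(1) by auto
  have small: "n * (p + r + 1) + 18 \<le> 6 * n"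
  proof -
    have "n * (card I + 1) \<le> 6 * ?t" using x(2) by (simp add: q_def I_def A_def B_def)
    then show ?thesis using few unfolding Ipr by linarith
  qed
  have "card A * card B \<le> n\<^sup>2 div 4" using mult_le_square_div4 n by metis
  then obtain D where D: "n\<^sup>2 div 4 = card A * card B + D" using le_Suc_ex by blast
  have gap: "card A \<le> card B + D + 1" "card B \<le> card A + D + 1"
    using side_gap[of "card A" "card B" D] side_gap[of "card B" "card A" D] D n
    by (simp_all add: add.commute mult.commute)
  \<comment> \<open>Here \<open>card E = card A * card B + D + 1\<close>. In particular some inner
    edge exists.\<close>
  have miss: "k + D + 1 \<le> p + r"
    using missing_pairs_le[OF G AB] D assms(4) Ipr unfolding I_def[symmetric] k_def[symmetric] by linarith
  \<comment> \<open>In \<open>small\<close>, the value 3 leaves \<open>18 \<le> 2 * n\<close> and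
    the value 4 leaves \<open>18 \<le> n\<close>.\<close>
  have range: "p + r = 1 \<or> p + r = 2 \<or> p + r = 3 \<and> 9 \<le> card A + card B
      \<or> p + r = 4 \<and> 18 \<le> card A + card B"
  proof -
    have "p + r < 5"
    proof (rule ccontr)
      assume "\<not> p + r < 5"
      then have "n * 6 \<le> n * (p + r + 1)" by (intro mult_le_mono2) simp
      then show False using small by linarith
    qed
    then have "p + r = 1 \<or> p + r = 2 \<or> p + r = 3 \<or> p + r = 4" using miss by linarith
    then show ?thesis using small unfolding n by (elim disjE) simp_all
  qed
  show "triangle_covering_number V E = 1"
  proof (cases "\<exists>v. \<forall>e\<in>I. v \<in> e")
    case True
    then obtain v where v: "\<forall>e\<in>I. v \<in> e" by blast
    have "v \<in> T" if "T \<in> triangles V E" for T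
      using triangle_has_inner[OF G AB(1) that] v by (auto simp: I_def)
    moreover from this tpos have "v \<in> V" by (auto simp: triangles_def)
    ultimately show ?thesis using covering_number_1[OF G tpos] by blast
  next
    case no_star: False
    have "p + r \<noteq> 1"
    proof
      assume "p + r = 1"
      then obtain e where "I = {e}" using Ipr by (metis card_1_singletonE)
      moreover have "e \<noteq> {}" using ne \<open>I = {e}\<close> by (auto simp: I_def inner_def)
      ultimately show False using no_star by blast
    qed
    note range = range this
    have hits: "card {e \<in> I. v \<in> e} \<le> p + r - 1" for v
    proof -
      have "{e \<in> I. v \<in> e} \<subset> I" using no_star by blast
      from psubset_card_mono[OF finI this] show ?thesis using Ipr by linarith
    qed
    have "card A + card B \<le> ?t + 2"
    proof (cases "p = 0 \<or> r = 0")
      case True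
      \<comment> \<open>All inner edges lie in one part, so only one end of a missing pair can meet
        them, and by \<open>hits\<close> that end avoids at least one of them.\<close>
      have "card {e \<in> I. u \<in> e \<or> v \<in> e} \<le> p + r - 1" if "u \<in> A" "v \<in> B" for u v
      proof -
        have "{e \<in> E. e \<subseteq> A} = {} \<or> {e \<in> E. e \<subseteq> B} = {}"
          using True finE by (auto simp: p_def r_def)
        then have "{e \<in> I. u \<in> e \<or> v \<in> e} = {e \<in> I. u \<in> e} \<or> {e \<in> I. u \<in> e \<or> v \<in> e} = {e \<in> I. v \<in> e}"
          using that AB(2) by (auto simp: I_def inner_def)
        then show ?thesis by (elim disjE) (simp_all only: hits)
      qed
      then have "p * card B + r * card A \<le> ?t + k * (p + r - 1)"
        using triangles_from_inner[OF G AB, of "p + r - 1"]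
        by (simp add: p_def r_def k_def I_def)
      \<comment> \<open>The two instances, with the parts interchanged, serve \<open>r = 0\<close>
        and \<open>p = 0\<close>.\<close>
      with True show ?thesis
        using count_one_side[of "card A" "card B" D k "p + r" ?t]
          count_one_side[of "card B" "card A" D k "p + r" ?t] gap miss range
        by (auto simp: add.commute)
    next
      case False
      \<comment> \<open>With inner edges on both sides the trivial bound is enough.\<close>
      have "card {e \<in> I. u \<in> e \<or> v \<in> e} \<le> p + r" for u v
        unfolding Ipr[symmetric] by (rule card_mono[OF finI]) auto
      then have "p * card B + r * card A \<le> ?t + k * (p + r)"
        using triangles_from_inner[OF G AB, of "p + r"] by (simp add: p_def r_def k_def I_def)
      with False show ?thesis
        using count_both_sides[OF gap miss] range by auto
    qed
    then show ?thesis using n few by simp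
  qed
qed

end
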